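(* Let $$p_2 = (x_1y_2 + x_2y_1)(y_1 + y_2) - 2(x_1+x_2)y_1y_2 \in \mathbb{R}[x_1,x_2,y_1,y_2],$$ and let $$\Delta_2 = \{(x_1,x_2,y_1,y_2) \in (\mathbb{R}\setminus\{0\})^{4} : x_1 = x_2,\ y_1 = y_2\}.$$ Let $a = (a_1,a_2,b_1,b_2) \in \mathbb{R}_{>0}^{4}$ with $p_2(a) = 0$, where the coordinates are ordered as $(x_1,x_2,y_1,y_2)$. Then $$\operatorname{RLCT}_a(p_2) = \begin{cases} (1,2) & \text{if } a \in \Delta_2, \\ (1,1) & \text{otherwise.}\end{cases}$$
   Context: Real log canonical threshold. Let $p$ be a real-valued function, not identically zero near $a$, that is real analytic on a neighborhood of a point $a \in \mathbb{R}^d$, with $p(a) = 0$. For an open neighborhood $W$ of $a$ with compact closure on which $p$ is analytic, and for $\varepsilon>0$, put $T_p(\varepsilon) = \{w \in W : |p(w)| \le \varepsilon\}$ and let $\operatorname{vol}$ denote $d$-dimensional Lebesgue measure. It is known that if $W$ is chosen small enough, there are $C>0$, $\lambda \in \mathbb{Q}_{>0}$ and $m \in \{1,\ldots,d\}$ such that $\operatorname{vol} T_p(\varepsilon)$ is asymptotically equal to $C \cdot \varepsilon^{\lambda}(-\log \varepsilon)^{m-1}$ as $\varepsilon \to 0$ (the quotient tends to $1$), and the pair $(\lambda,m)$ does not depend on the choice of the sufficiently small $W$ (there is a $W$ such that all open neighborhoods $W' \subseteq W$ of $a$ give the same pair $(\lambda,m)$). One writes $\operatorname{RLCT}_a(p)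 = (\lambda,m)$. Equivalently, for $W$ small enough, the zeta function $\zeta_{p,a}(z) = \int_W |p(w)|^{-z}\,dw$ continues uniquely to a meromorphic function on $\mathbb{C}$ all of whose poles are positive rational numbers; $\lambda$ is its smallest pole and $m$ is the order of that pole. *)

theory Defs
  imports "HOL-Analysis.Analysis" "HOL-Library.Landau_Symbols"
begin

text \<open>Local representability by convergent power series; multi-indices are functions
  \<^typ>\<open>'n \<Rightarrow> nat\<close>, and summability over them is unconditional.\<close>

definition real_analytic_on :: "(real ^ 'n \<Rightarrow> real) \<Rightarrow> (real ^ 'n) set \<Rightarrow> bool"
    (infixl "real'_analytic'_on" 50) where
  "p real_analytic_on S \<longleftrightarrow>
     (\<forall>w\<in>S. \<exists>r>0. \<exists>c :: ('n \<Rightarrow> nat) \<Rightarrow> real. \<forall>x\<in>ball w r.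
        ((\<lambda>\<alpha>. c \<alpha> * (\<Prod>i\<in>UNIV. (x $ i - w $ i) ^ \<alpha> i)) has_sum p x) UNIV)"

definition tube :: "(real ^ 'n \<Rightarrow> real) \<Rightarrow> (real ^ 'n) set \<Rightarrow> real \<Rightarrow> (real ^ 'n) set" where
  "tube p W \<epsilon> = {w \<in> W. \<bar>p w\<bar> \<le> \<epsilon>}"

definition admissible_nbhd :: "(real ^ 'n \<Rightarrow> real) \<Rightarrow> real ^ 'n \<Rightarrow> (real ^ 'n) set \<Rightarrow> bool" where
  "admissible_nbhd p a W \<longleftrightarrow>
     open W \<and> a \<in> W \<and> compact (closure W) \<and> p real_analytic_on W"

definition volume_pair :: "(real ^ 'n \<Rightarrow> real) \<Rightarrow> (real ^ 'n) set \<Rightarrow> real \<times> nat \<Rightarrow> bool" where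
  "volume_pair p W = (\<lambda>(l, m).
     l \<in> \<rat> \<and> l > 0 \<and> m \<in> {1..CARD('n)} \<and>
     (\<exists>C>0. (\<lambda>\<epsilon>. measure lebesgue (tube p W \<epsilon>))
               \<sim>[at_right 0] (\<lambda>\<epsilon>. C * \<epsilon> powr l * (- ln \<epsilon>) ^ (m - 1))))"

text \<open>The relation ``the real log canonical threshold of \<open>p\<close> at \<open>a\<close> is \<open>(l, m)\<close>'':
  arbitrarily small neighbourhoods \<open>W\<close> have volume asymptotics with pair \<open>(l, m)\<close>, and there is
  a neighbourhood all of whose open subneighbourhoods \<open>W'\<close> yield no other pair.

  One cannot ask that every small open \<open>W'\<close> have such asymptotics.  For \<open>p (u, s) = u\<close> in the
  plane, let \<open>W'\<close> be a small ball around \<open>0\<close> together with the points \<open>(u, s)\<close> where \<open>s\<close> lies in an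
  interval away from \<open>0\<close> and \<open>\<bar>u\<bar>\<close> in an open set whose density in \<open>(0, \<epsilon>)\<close> oscillates as
  \<open>\<epsilon> \<rightarrow> 0\<close>: then the volume divided by \<open>\<epsilon>\<close> stays between positive constants but does not
  converge.  The first condition does bound the volume for every sufficiently small \<open>W'\<close> above and
  below by constant multiples of \<open>\<epsilon> powr l * (- ln \<epsilon>) ^ (m - 1)\<close>, by monotonicity in \<open>W'\<close>.\<close>

definition has_RLCT :: "(real ^ 'n \<Rightarrow> real) \<Rightarrow> real ^ 'n \<Rightarrow> real \<times> nat \<Rightarrow> bool" where
  "has_RLCT p a lm \<longleftrightarrow>
     p a = 0 \<and> \<not> (\<forall>\<^sub>F w in nhds a. p w = 0) \<and>
     (\<forall>U. open U \<and> a \<in> U \<longrightarrow> (\<exists>W\<subseteq>U. admissible_nbhd p a W \<and> volume_pair p W lm)) \<and>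
     (\<exists>W. admissible_nbhd p a W \<and>
          (\<forall>W'\<subseteq>W. open W' \<and> a \<in> W' \<longrightarrow> (\<forall>lm'. volume_pair p W' lm' \<longrightarrow> lm' = lm)))"

lemma has_RLCT_unique:
  assumes "has_RLCT p a lm" and "has_RLCT p a lm'"
  shows "lm = lm'"
proof -
  obtain V where V: "admissible_nbhd p a V"
    and uniq: "\<forall>W\<subseteq>V. open W \<and> a \<in> W \<longrightarrow> (\<forall>k. volume_pair p W k \<longrightarrow> k = lm')"
    using assms(2) unfolding has_RLCT_def by (elim conjE exE)
  have "open V \<and> a \<in> V"
    using V by (simp add: admissible_nbhd_def)
  moreover have "\<forall>U. open U \<and> a \<in> U \<longrightarrow>
      (\<exists>W\<subseteq>U. admissible_nbhd p a W \<and> volume_pair p W lm)"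
    using assms(1) unfolding has_RLCT_def by (elim conjE)
  ultimately obtain W where W: "W \<subseteq> V" "admissible_nbhd p a W" "volume_pair p W lm"
    by blast
  have "open W \<and> a \<in> W"
    using W(2) by (simp add: admissible_nbhd_def)
  with uniq W(1,3) show ?thesis
    by blast
qed

text \<open>Coordinates of \<^typ>\<open>real ^ 4\<close> are ordered as \<open>(x\<^sub>1, x\<^sub>2, y\<^sub>1, y\<^sub>2)\<close>.\<close>

definition p2 :: "real ^ 4 \<Rightarrow> real" where
  "p2 w = (let x1 = w $ 1; x2 = w $ 2; y1 = w $ 3; y2 = w $ 4 in
     (x1 * y2 + x2 * y1) * (y1 + y2) - 2 * (x1 + x2) * y1 * y2)"

definition Delta2 :: "(real ^ 4) set" where
  "Delta2 = {w. (\<forall>i. w $ i \<noteq> 0) \<and> w $ 1 = w $ 2 \<and> w $ 3 = w $ 4}"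

end

theory Submission
  imports Defs "HOL-Real_Asymp.Real_Asymp"
begin

text \<open>The polynomial factors: \<open>p2 = (y\<^sub>2 - y\<^sub>1) * (x\<^sub>1 * y\<^sub>2 - x\<^sub>2 * y\<^sub>1)\<close>.  Call the factors \<open>u\<close> (the gap)
  and \<open>v\<close> (the minor).  Where \<open>y\<^sub>2 > 0\<close>, the functions \<open>(y\<^sub>2, x\<^sub>2, u, v)\<close> are coordinates, because
  \<open>y\<^sub>1 = y\<^sub>2 - u\<close> and \<open>x\<^sub>1 = (v + x\<^sub>2 * y\<^sub>1) / y\<^sub>2\<close>, and the volume element is \<open>1 / y\<^sub>2\<close> times that of
  the new coordinates.  In them \<open>p2\<close> is the monomial \<open>u * v\<close>.  At a positive zero \<open>a\<close>, both factors
  vanish exactly on the diagonal \<open>x\<^sub>1 = x\<^sub>2\<close>, \<open>y\<^sub>1 = y\<^sub>2\<close>; this is the normal crossing case with pair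
  \<open>(1, 2)\<close>.  Elsewhere exactly one factor vanishes, the zero set is smooth there, and the pair is
  \<open>(1, 1)\<close>.

  The volumes can be computed without an asymptotic analysis.  As neighbourhood take a cube in the
  new coordinates (\<open>cell\<close>).  As \<open>u * v\<close> does not involve \<open>x\<^sub>2\<close> and \<open>y\<^sub>2\<close>, Tonelli's theorem and affine
  substitutions in \<open>x\<^sub>1\<close> and \<open>y\<^sub>1\<close> show that the volume of the tube is a constant times the area of
  \<open>\<bar>u * v\<bar> \<le> \<epsilon>\<close> in a square (\<open>emeasure_tube_in_factor_coordinates\<close>).  For small \<open>\<epsilon>\<close> and a square
  of side \<open>2 * d\<close> centred at the origin this area is \<open>4 * \<epsilon> * (1 + ln (d\<^sup>2 / \<epsilon>))\<close> (\<open>plane_tube_area_cross\<close>); for one that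
  meets only one of the axes, in a chord through its centre, it is proportional to \<open>\<epsilon>\<close>
  (\<open>plane_tube_area_one_zero\<close>).

  That no small open neighbourhood yields another pair follows from monotonicity alone: such a
  neighbourhood lies between two cells, so its tube volume has the same order of growth, and
  different pairs have different orders of growth (\<open>has_RLCT_if_small_nbhds\<close>).\<close>

section \<open>Polynomial functions are real analytic\<close>

lemma bounded_linear_cart:
  fixes f :: "real ^ 'n \<Rightarrow> real"
  assumes "bounded_linear f"
  shows "f x = (\<Sum>i\<in>UNIV. f (axis i 1) * x $ i)"
proof -
  interpret bounded_linear f by fact
  have "f x = f (\<Sum>i\<in>UNIV. x $ i *\<^sub>R axis i 1)"
    by (simp add: basis_expansion flip: scalar_mult_eq_scaleR)
  also have "\<dots> = (\<Sum>i\<in>UNIV. f (axis i 1) * x $ i)"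
    by (simp add: sum scale mult.commute)
  finally show ?thesis .
qed

text \<open>Finite sums of scaled monomials centred at \<open>w\<close>.  The same multi-index may occur at several
  summation indices, so that products are again of this form without any regrouping of terms.\<close>

definition finite_expansion_at ::
    "real ^ 'n \<Rightarrow> (real ^ 'n \<Rightarrow> real) \<Rightarrow> bool" where
  "finite_expansion_at w f \<longleftrightarrow> (\<exists>(K :: nat set) b \<gamma>. finite K \<and>
     (\<forall>x. f x = (\<Sum>k\<in>K. b k * (\<Prod>i\<in>UNIV. (x $ i - w $ i) ^ (\<gamma> k i)))))"

text \<open>Finite index sets of any type may be used, which lets sums and products be indexed by disjoint unions
  and by cartesian products.\<close>

lemma finite_expansion_atI:
  assumes I: "finite (I :: 'i set)"
    and f: "\<And>x. f x = (\<Sum>k\<in>I. b k * (\<Prod>i\<in>UNIV. (x $ i - w $ i) ^ (\<gamma> k i)))"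
  shows "finite_expansion_at w f"
proof -
  obtain h :: "nat \<Rightarrow> 'i" where h: "bij_betw h {0..<card I} I"
    using ex_bij_betw_nat_finite[OF I] by blast
  have "f x = (\<Sum>k\<in>{0..<card I}. b (h k) * (\<Prod>i\<in>UNIV. (x $ i - w $ i) ^ (\<gamma> (h k) i)))" for x
    unfolding f by (rule sum.reindex_bij_betw[OF h, symmetric])
  then show ?thesis
    unfolding finite_expansion_at_def
    by (intro exI[of _ "{0..<card I}"] exI[of _ "b \<circ> h"] exI[of _ "\<gamma> \<circ> h"]) simp
qed

lemma finite_expansion_at_polynomial:
  fixes f :: "real ^ 'n \<Rightarrow> real"
  assumes "real_polynomial_function f"
  shows "finite_expansion_at w f"
  using assms
proof induction
  case (linear f)
  have "f x = (\<Sum>k\<in>(UNIV :: 'n option set). (case k of None \<Rightarrow> f w | Some j \<Rightarrow> f (axis j 1)) *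
       (\<Prod>i\<in>UNIV. (x $ i - w $ i) ^ (if k = Some i then 1 else 0)))" for x
  proof -
    have "f x = f w + f (x - w)"
      using linear by (simp add: bounded_linear.linear linear_diff)
    moreover have "f (x - w) = (\<Sum>j\<in>UNIV. f (axis j 1) * (x $ j - w $ j))"
      using bounded_linear_cart[OF linear, of "x - w"] by simp
    moreover have "(\<Prod>i\<in>UNIV. (x $ i - w $ i) ^ (if j = i then 1 else 0)) = x $ j - w $ j" for j
    proof -
      have "(\<Prod>i\<in>UNIV. (x $ i - w $ i) ^ (if j = i then 1 else 0)) = (\<Prod>i\<in>UNIV. if j = i then x $ i - w $ i else 1)"
        by (intro prod.cong) auto
      then show ?thesis by simp
    qed
    ultimately show ?thesis
      by (simp add: UNIV_option_conv sum.reindex)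
  qed
  then show ?case by (intro finite_expansion_atI[OF finite])
next
  case (const c)
  show ?case
    by (rule finite_expansion_atI[of "UNIV :: unit set" _ "\<lambda>_. c" _ "\<lambda>_ _. 0"]) simp_all
next
  case (add f g)
  obtain K :: "nat set" and b \<gamma> where K: "finite K"
    and f: "\<And>x. f x = (\<Sum>k\<in>K. b k * (\<Prod>i\<in>UNIV. (x $ i - w $ i) ^ \<gamma> k i))"
    using add.IH(1) unfolding finite_expansion_at_def by blast
  obtain L :: "nat set" and d \<delta> where L: "finite L"
    and g: "\<And>x. g x = (\<Sum>k\<in>L. d k * (\<Prod>i\<in>UNIV. (x $ i - w $ i) ^ \<delta> k i))"
    using add.IH(2) unfolding finite_expansion_at_def by blast
  show ?case
    by (rule finite_expansion_atI[of "K <+> L" _ "case_sum b d" _ "case_sum \<gamma> \<delta>"])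
       (use K L in \<open>simp_all add: f g sum.Plus\<close>)
next
  case (mult f g)
  obtain K :: "nat set" and b \<gamma> where K: "finite K"
    and f: "\<And>x. f x = (\<Sum>k\<in>K. b k * (\<Prod>i\<in>UNIV. (x $ i - w $ i) ^ \<gamma> k i))"
    using mult.IH(1) unfolding finite_expansion_at_def by blast
  obtain L :: "nat set" and d \<delta> where L: "finite L"
    and g: "\<And>x. g x = (\<Sum>k\<in>L. d k * (\<Prod>i\<in>UNIV. (x $ i - w $ i) ^ \<delta> k i))"
    using mult.IH(2) unfolding finite_expansion_at_def by blast
  show ?case
    by (rule finite_expansion_atI[of "K \<times> L" _ "\<lambda>(k, l). b k * d l" _ "\<lambda>(k, l) i. \<gamma> k i + \<delta> l i"])
       (use K L in \<open>auto simp: f g sum_product sum.cartesian_product power_add prod.distrib mult_ac intro!: sum.cong\<close>)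
qed

text \<open>The coefficient of a multi-index collects all summands with that multi-index; only finitely many
  coefficients are nonzero, so the power series converges everywhere.\<close>

lemma real_polynomial_function_imp_real_analytic_on:
  fixes f :: "real ^ 'n \<Rightarrow> real"
  assumes "real_polynomial_function f"
  shows "f real_analytic_on S"
  unfolding real_analytic_on_def
proof (intro ballI exI[of _ 1] conjI)
  fix w :: "real ^ 'n"
  obtain K :: "nat set" and b and \<gamma> :: "nat \<Rightarrow> 'n \<Rightarrow> nat" where K: "finite K"
    and f: "\<And>x. f x = (\<Sum>k\<in>K. b k * (\<Prod>i\<in>UNIV. (x $ i - w $ i) ^ (\<gamma> k i)))"
    using finite_expansion_at_polynomial[OF assms, of w] unfolding finite_expansion_at_def by blast
  let ?c = "\<lambda>\<alpha>. \<Sum>k | k \<in> K \<and> \<gamma> k = \<alpha>. b k"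
  have "((\<lambda>\<alpha>. ?c \<alpha> * (\<Prod>i\<in>UNIV. (x $ i - w $ i) ^ \<alpha> i)) has_sum f x) UNIV" for x
  proof (rule has_sum_finite_neutralI[where B = "\<gamma> ` K"])
    have "f x = (\<Sum>\<alpha>\<in>\<gamma> ` K. \<Sum>k | k \<in> K \<and> \<gamma> k = \<alpha>. b k * (\<Prod>i\<in>UNIV. (x $ i - w $ i) ^ (\<gamma> k i)))"
      unfolding f using K by (rule sum.image_gen)
    then show "f x = (\<Sum>\<alpha>\<in>\<gamma> ` K. ?c \<alpha> * (\<Prod>i\<in>UNIV. (x $ i - w $ i) ^ \<alpha> i))"
      by (simp add: sum_distrib_right)
    show "?c \<alpha> * (\<Prod>i\<in>UNIV. (x $ i - w $ i) ^ \<alpha> i) = 0" if "\<alpha> \<in> UNIV - \<gamma> ` K" for \<alpha>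
    proof -
      have "?c \<alpha> = 0" using that by (intro sum.neutral) auto
      then show ?thesis by simp
    qed
  qed (use K in auto)
  then show "\<exists>c. \<forall>x\<in>ball w 1. ((\<lambda>\<alpha>. c \<alpha> * (\<Prod>i\<in>UNIV. (x $ i - w $ i) ^ \<alpha> i)) has_sum f x) UNIV"
    by (intro exI[of _ ?c]) simp
qed simp

section \<open>Growth scales and a criterion for the threshold\<close>

definition growth :: "real \<Rightarrow> nat \<Rightarrow> real \<Rightarrow> real" where
  "growth l k \<epsilon> = \<epsilon> powr l * (- ln \<epsilon>) ^ k"

text \<open>Needed to refute \<open>growth l k \<in> o(growth l k)\<close>.\<close>

lemma growth_nonzero: "\<not> (\<forall>\<^sub>F \<epsilon> in at_right 0. growth l k \<epsilon> = 0)"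
proof
  assume "\<forall>\<^sub>F \<epsilon> in at_right 0. growth l k \<epsilon> = 0"
  moreover have "\<forall>\<^sub>F \<epsilon>::real in at_right 0. 0 < \<epsilon> \<and> \<epsilon> < 1"
    by (rule eventually_at_rightI[of 0 1]) auto
  ultimately have "\<forall>\<^sub>F \<epsilon>::real in at_right 0. False"
    by eventually_elim (auto simp: growth_def)
  then show False by (simp add: trivial_limit_at_right_real)
qed

text \<open>Near \<open>0\<close> a smaller exponent of \<open>\<epsilon>\<close> dominates; for equal exponents, a larger power of the logarithm
  does.\<close>

lemma growth_bigtheta_imp_le:
  assumes "growth l k \<in> \<Theta>[at_right 0](growth l' k')"
  shows "l' \<le> l \<and> (l = l' \<longrightarrow> k \<le> k')"
proof (rule ccontr)
  assume "\<not> ?thesis"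
  then consider "l < l'" | "l = l'" "k' < k" by linarith
  then have "growth l' k' \<in> o[at_right 0](growth l k)"
    by cases (unfold growth_def, real_asymp+)
  then have "\<forall>\<^sub>F \<epsilon> in at_right 0. growth l k \<epsilon> = 0"
    using assms by (intro landau_o.big_small_asymmetric[of "growth l k" _ "growth l' k'"]) (auto dest: bigthetaD1)
  then show False using growth_nonzero by blast
qed

lemma growth_bigtheta_unique:
  assumes "growth l k \<in> \<Theta>[at_right 0](growth l' k')"
  shows "l = l' \<and> k = k'"
  using growth_bigtheta_imp_le[OF assms] growth_bigtheta_imp_le[of l' k' l k] assms
  by (auto simp: bigtheta_sym)

lemma volume_pair_bigtheta:
  assumes "volume_pair p W (l, m)"
  shows "(\<lambda>\<epsilon>. measure lebesgue (tube p W \<epsilon>)) \<in> \<Theta>[at_right 0](growth l (m - 1))"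
proof -
  obtain C where C: "C > 0" "(\<lambda>\<epsilon>. measure lebesgue (tube p W \<epsilon>))
               \<sim>[at_right 0] (\<lambda>\<epsilon>. C * \<epsilon> powr l * (- ln \<epsilon>) ^ (m - 1))"
    using assms unfolding volume_pair_def by auto
  have "(\<lambda>\<epsilon>. measure lebesgue (tube p W \<epsilon>)) \<in> \<Theta>[at_right 0](\<lambda>\<epsilon>. C * growth l (m - 1) \<epsilon>)"
    using asymp_equiv_imp_bigtheta[OF C(2)] by (simp add: growth_def mult.assoc)
  then show ?thesis using C(1) by simp
qed

lemma tube_lmeasurable:
  assumes p: "continuous_on UNIV p" and W: "open W" "bounded W"
  shows "tube p W \<epsilon> \<in> lmeasurable"
proof -
  have "closed {w. \<bar>p w\<bar> \<le> \<epsilon>}"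
    by (intro closed_Collect_le continuous_intros p)
  moreover have "tube p W \<epsilon> = W \<inter> {w. \<bar>p w\<bar> \<le> \<epsilon>}"
    by (auto simp: tube_def)
  ultimately show ?thesis
    using W by (auto intro!: bounded_set_imp_lmeasurable bounded_Int)
qed

text \<open>Volume is monotone in the neighbourhood, so the tube of \<open>W'\<close> is squeezed between two volumes of
  order \<open>growth l (m - 1)\<close> and has this order itself.\<close>

lemma volume_pair_squeeze:
  assumes p: "continuous_on UNIV p"
    and sub: "V \<subseteq> W'" "W' \<subseteq> W" and opn: "open V" "open W'" "open W" and bdd: "bounded W"
    and V: "volume_pair p V (l, m)" and W: "volume_pair p W (l, m)"
    and W': "volume_pair p W' (l', m')"
  shows "l' = l \<and> m' = m"
proof -
  let ?vol = "\<lambda>W \<epsilon>. measure lebesgue (tube p W \<epsilon>)"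
  have bdd': "bounded W'" "bounded V" using bdd sub bounded_subset by blast+
  have "?vol V \<epsilon> \<le> ?vol W' \<epsilon>" "?vol W' \<epsilon> \<le> ?vol W \<epsilon>" for \<epsilon>
    using tube_lmeasurable[OF p] opn bdd bdd' sub
    by (auto intro!: measure_mono_fmeasurable simp: tube_def fmeasurableD)
  then have "?vol V \<in> O[at_right 0](?vol W')" "?vol W' \<in> O[at_right 0](?vol W)"
    by (auto intro!: landau_o.big_mono always_eventually)
  moreover have "growth l' (m' - 1) \<in> \<Theta>[at_right 0](?vol W')"
    and "?vol V \<in> \<Theta>[at_right 0](growth l (m - 1))" "?vol W \<in> \<Theta>[at_right 0](growth l (m - 1))"
    using volume_pair_bigtheta[OF V] volume_pair_bigtheta[OF W] volume_pair_bigtheta[OF W']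
    by (auto simp: bigtheta_sym)
  ultimately have "growth l' (m' - 1) \<in> \<Theta>[at_right 0](growth l (m - 1))"
    by (meson bigthetaD1 bigthetaD2 bigthetaI landau_o.big_trans bigomega_iff_bigo)
  then have "l' = l" "m' - 1 = m - 1"
    using growth_bigtheta_unique by auto
  moreover have "m \<ge> 1" "m' \<ge> 1"
    using V W' by (auto simp: volume_pair_def)
  ultimately show ?thesis by linarith
qed

text \<open>If \<open>p\<close> vanished on \<open>W\<close>, then the tube would be all of \<open>W\<close> for every \<open>\<epsilon>\<close>, whereas its volume has to
  tend to \<open>0\<close>.\<close>

lemma volume_pair_imp_nonzero:
  assumes "volume_pair p W lm" and W: "open W" "bounded W" "W \<noteq> {}"
  shows "\<exists>w\<in>W. p w \<noteq> 0"
proof (rule ccontr)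
  assume zero: "\<not> ?thesis"
  obtain l m where lm: "lm = (l, m)" by fastforce
  have l: "l > 0" using assms(1) by (simp add: volume_pair_def lm)
  have "\<forall>\<^sub>F \<epsilon> in at_right 0. measure lebesgue (tube p W \<epsilon>) = measure lebesgue W"
  proof (rule eventually_at_rightI[of 0 1])
    fix \<epsilon> :: real assume "\<epsilon> \<in> {0<..<1}"
    then have "tube p W \<epsilon> = W" using zero by (auto simp: tube_def)
    then show "measure lebesgue (tube p W \<epsilon>) = measure lebesgue W" by simp
  qed simp
  then have "(\<lambda>_. measure lebesgue W) \<in> O[at_right 0](growth l (m - 1))"
    using bigthetaD1[OF volume_pair_bigtheta[OF assms(1)[unfolded lm]]]
    by (rule landau_o.big.in_cong[THEN iffD1])
  moreover have "growth l (m - 1) \<in> o[at_right 0](\<lambda>_. 1 :: real)"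
    unfolding growth_def using l by real_asymp
  ultimately have "(\<lambda>_ :: real. measure lebesgue W) \<in> o[at_right 0](\<lambda>_. 1 :: real)"
    by (rule landau_o.big_small_trans)
  then have "measure lebesgue W = 0"
    by (auto dest!: smalloD_tendsto simp: tendsto_const_iff trivial_limit_at_right_real)
  moreover have "W \<in> lmeasurable" using W by (simp add: lmeasurable_open)
  ultimately have "negligible W"
    by (simp add: negligible_iff_measure)
  then show False using W open_not_negligible by blast
qed

text \<open>Arbitrarily small neighbourhoods with a common pair are enough: one of them serves as the outer
  neighbourhood in the uniqueness clause, and every open \<open>W'\<close> inside it contains another.\<close>

lemma has_RLCT_if_small_nbhds:
  assumes p: "continuous_on UNIV p" "p a = 0"
    and small: "\<And>U. open U \<Longrightarrow> a \<in> U \<Longrightarrow> \<exists>W\<subseteq>U. admissible_nbhd p a W \<and> volume_pair p W lm"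
  shows "has_RLCT p a lm"
proof -
  have adm: "open W \<and> a \<in> W \<and> bounded W" if "admissible_nbhd p a W" for W
    using that compact_imp_bounded bounded_subset closure_subset
    unfolding admissible_nbhd_def by blast
  have "\<not> (\<forall>\<^sub>F w in nhds a. p w = 0)"
  proof
    assume "\<forall>\<^sub>F w in nhds a. p w = 0"
    then obtain S where S: "open S" "a \<in> S" "\<forall>w\<in>S. p w = 0"
      unfolding eventually_nhds by blast
    then obtain W where "W \<subseteq> S" "admissible_nbhd p a W" "volume_pair p W lm"
      using small by blast
    then show False using volume_pair_imp_nonzero[of p W lm] adm S(3) by blast
  qed
  moreover obtain W where W: "admissible_nbhd p a W" "volume_pair p W lm"
    using small[of UNIV] by auto
  have "lm' = lm" if W': "W' \<subseteq> W" "open W'" "a \<in> W'" "volume_pair p W' lm'" for W' lm'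
  proof -
    obtain V where V: "V \<subseteq> W'" "admissible_nbhd p a V" "volume_pair p V lm"
      using small W' by blast
    obtain l m l' m' where "lm = (l, m)" "lm' = (l', m')" by fastforce
    then show ?thesis
      using volume_pair_squeeze[OF p(1) V(1) W'(1), of l m l' m'] V W W' adm by blast
  qed
  ultimately show ?thesis
    unfolding has_RLCT_def using p(2) small W(1) by blast
qed

section \<open>Lebesgue measure on four-space as an iterated integral\<close>

lemma prod_4: "prod f (UNIV :: 4 set) = f 1 * f 2 * f 3 * f 4"
  unfolding UNIV_4 by (simp add: mult_ac)

lemma prod_Basis_cart:
  fixes f :: "real ^ 'n \<Rightarrow> 'a :: comm_monoid_mult"
  shows "(\<Prod>b\<in>Basis. f b) = (\<Prod>i\<in>UNIV. f (axis i 1))"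
proof -
  have Basis: "Basis = range (\<lambda>i :: 'n. axis i (1 :: real))"
    by (auto simp: Basis_vec_def)
  moreover have "inj (\<lambda>i :: 'n. axis i (1 :: real))"
    by (auto simp: inj_on_def axis_eq_axis)
  ultimately show ?thesis unfolding Basis by (simp only: prod.reindex o_def)
qed

text \<open>The coordinates are listed in the order of integration, outermost first: the substitutions below
  replace \<open>x\<^sub>1\<close> with the other coordinates fixed, and then \<open>y\<^sub>1\<close>.\<close>

definition point_of :: "real \<times> real \<times> real \<times> real \<Rightarrow> real ^ 4" where
  "point_of = (\<lambda>(y2, x2, y1, x1). vector [x1, x2, y1, y2])"

lemma vector_4 [simp]:
  "(vector [x, y, z, w] :: 'a :: zero ^ 4) $ 1 = x"
  "(vector [x, y, z, w] :: 'a :: zero ^ 4) $ 2 = y"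
  "(vector [x, y, z, w] :: 'a :: zero ^ 4) $ 3 = z"
  "(vector [x, y, z, w] :: 'a :: zero ^ 4) $ 4 = w"
  unfolding vector_def by simp_all

lemma point_of_nth [simp]:
  "point_of (y2, x2, y1, x1) $ 1 = x1" "point_of (y2, x2, y1, x1) $ 2 = x2"
  "point_of (y2, x2, y1, x1) $ 3 = y1" "point_of (y2, x2, y1, x1) $ 4 = y2"
  by (simp_all add: point_of_def)

lemma continuous_point_of: "continuous_on UNIV point_of"
proof (rule continuous_on_vec_lambda[of UNIV "\<lambda>i q. point_of q $ i", simplified])
  show "continuous_on UNIV (\<lambda>q. point_of q $ i)" for i
    using exhaust_4[of i] by (elim disjE) (simp_all add: point_of_def case_prod_unfold continuous_intros)
qed

lemma borel_measurable_point_of [measurable]: "point_of \<in> borel_measurable borel"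
  by (rule borel_measurable_continuous_onI[OF continuous_point_of])

lemma emeasure_lborel_Times:
  fixes A :: "'a :: euclidean_space set" and B :: "'b :: euclidean_space set"
  assumes "A \<in> sets borel" "B \<in> sets borel"
  shows "emeasure lborel (A \<times> B) = emeasure lborel A * emeasure lborel B"
  using assms by (simp add: lborel.emeasure_pair_measure_Times flip: lborel_prod)

text \<open>Lebesgue measure is determined by its values on boxes, and \<open>point_of\<close> pulls boxes back to products
  of intervals.\<close>

lemma lborel_eq_distr_point_of: "lborel = distr lborel borel point_of"
proof (rule lborel_eqI)
  fix l u :: "real ^ 4" assume lu: "\<And>b. b \<in> Basis \<Longrightarrow> l \<bullet> b \<le> u \<bullet> b"
  then have le: "l $ i \<le> u $ i" for i
    using lu[of "axis i 1"] by (simp add: inner_axis)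
  have "point_of -` box l u =
      {l $ 4<..<u $ 4} \<times> {l $ 2<..<u $ 2} \<times> {l $ 3<..<u $ 3} \<times> {l $ 1<..<u $ 1}"
    by (auto simp: mem_box_cart forall_4)
  then have "emeasure (distr lborel borel point_of) (box l u) =
      emeasure lborel
        ({l $ 4<..<u $ 4} \<times> {l $ 2<..<u $ 2} \<times> {l $ 3<..<u $ 3} \<times> {l $ 1<..<u $ 1})"
    by (simp add: emeasure_distr)
  also have "\<dots> = ennreal (u $ 4 - l $ 4) * (ennreal (u $ 2 - l $ 2) *
       (ennreal (u $ 3 - l $ 3) * ennreal (u $ 1 - l $ 1)))"
    using le by (simp add: emeasure_lborel_Times open_Times)
  also have "\<dots> = ennreal (\<Prod>b\<in>Basis. (u - l) \<bullet> b)"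
    using le by (simp add: prod_Basis_cart prod_4 inner_axis mult_ac ennreal_mult'')
  finally show "emeasure (distr lborel borel point_of) (box l u) = ennreal (\<Prod>b\<in>Basis. (u - l) \<bullet> b)" .
qed simp

lemma nn_integral_point_of:
  assumes [measurable]: "f \<in> borel_measurable (borel :: (real ^ 4) measure)"
  shows "(\<integral>\<^sup>+ w. f w \<partial>lborel) =
    (\<integral>\<^sup>+ y2. \<integral>\<^sup>+ x2. \<integral>\<^sup>+ y1. \<integral>\<^sup>+ x1. f (point_of (y2, x2, y1, x1)) \<partial>lborel \<partial>lborel \<partial>lborel \<partial>lborel)"
proof -
  have [measurable]: "(\<lambda>q. f (point_of q)) \<in> borel_measurable (borel \<Otimes>\<^sub>M (borel \<Otimes>\<^sub>M (borel \<Otimes>\<^sub>M borel)))"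
    by (simp add: borel_prod)
  have "(\<integral>\<^sup>+ w. f w \<partial>lborel) = (\<integral>\<^sup>+ q. f (point_of q) \<partial>(lborel \<Otimes>\<^sub>M (lborel \<Otimes>\<^sub>M (lborel \<Otimes>\<^sub>M lborel))))"
    by (subst lborel_eq_distr_point_of) (simp add: nn_integral_distr lborel_prod)
  also have "\<dots> = (\<integral>\<^sup>+ y2. \<integral>\<^sup>+ q. f (point_of (y2, q)) \<partial>(lborel \<Otimes>\<^sub>M (lborel \<Otimes>\<^sub>M lborel)) \<partial>lborel)"
    by (subst sigma_finite_measure.nn_integral_fst[symmetric]) (simp_all add: lborel_prod sigma_finite_lborel borel_prod)
  also have "\<dots> = (\<integral>\<^sup>+ y2. \<integral>\<^sup>+ x2. \<integral>\<^sup>+ q. f (point_of (y2, x2, q)) \<partial>(lborel \<Otimes>\<^sub>M lborel) \<partial>lborel \<partial>lborel)"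
    by (subst sigma_finite_measure.nn_integral_fst[symmetric]) (simp_all add: lborel_prod sigma_finite_lborel borel_prod)
  also have "\<dots> = (\<integral>\<^sup>+ y2. \<integral>\<^sup>+ x2. \<integral>\<^sup>+ y1. \<integral>\<^sup>+ x1. f (point_of (y2, x2, y1, x1)) \<partial>lborel \<partial>lborel \<partial>lborel \<partial>lborel)"
    by (subst sigma_finite_measure.nn_integral_fst[symmetric]) (simp_all add: lborel_prod sigma_finite_lborel borel_prod)
  finally show ?thesis .
qed

section \<open>Planar sublevel sets of a product of two coordinates\<close>

definition plane_tube :: "real set \<Rightarrow> real set \<Rightarrow> real \<Rightarrow> (real \<times> real) set" where
  "plane_tube U V \<epsilon> = {(u, v). u \<in> U \<and> v \<in> V \<and> \<bar>u * v\<bar> \<le> \<epsilon>}"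

lemma plane_tube_borel [measurable]:
  assumes [measurable]: "U \<in> sets borel" "V \<in> sets borel"
  shows "plane_tube U V \<epsilon> \<in> sets borel"
proof -
  have "{z \<in> space (borel \<Otimes>\<^sub>M borel). fst z \<in> U \<and> snd z \<in> V \<and> \<bar>fst z * snd z\<bar> \<le> \<epsilon>} \<in> sets (borel \<Otimes>\<^sub>M borel)"
    by measurable
  moreover have "plane_tube U V \<epsilon> = {z. fst z \<in> U \<and> snd z \<in> V \<and> \<bar>fst z * snd z\<bar> \<le> \<epsilon>}"
    by (auto simp: plane_tube_def)
  ultimately show ?thesis unfolding borel_prod by simp
qed

lemma plane_tube_area:
  assumes [measurable]: "U \<in> sets borel" "V \<in> sets borel"
  shows "emeasure lborel (plane_tube U V \<epsilon>) =
    (\<integral>\<^sup>+u. indicator U u * emeasure lborel {v \<in> V. \<bar>u * v\<bar> \<le> \<epsilon>} \<partial>lborel)"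
proof -
  have "plane_tube U V \<epsilon> \<in> sets (lborel \<Otimes>\<^sub>M lborel)"
    unfolding lborel_prod by simp
  then have "emeasure lborel (plane_tube U V \<epsilon>) = (\<integral>\<^sup>+u. emeasure lborel (Pair u -` plane_tube U V \<epsilon>) \<partial>lborel)"
    unfolding lborel_prod[symmetric] by (rule lborel.emeasure_pair_measure_alt)
  also have "\<dots> = (\<integral>\<^sup>+u. indicator U u * emeasure lborel {v \<in> V. \<bar>u * v\<bar> \<le> \<epsilon>} \<partial>lborel)"
    by (intro nn_integral_cong) (auto simp: plane_tube_def indicator_def)
  finally show ?thesis .
qed

lemma plane_tube_commute:
  assumes [measurable]: "U \<in> sets borel" "V \<in> sets borel"
  shows "emeasure lborel (plane_tube U V \<epsilon>) = emeasure lborel (plane_tube V U \<epsilon>)"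
proof -
  have "plane_tube U V \<epsilon> \<in> sets (lborel \<Otimes>\<^sub>M lborel)"
    unfolding lborel_prod by simp
  then have "emeasure lborel (plane_tube U V \<epsilon>) = (\<integral>\<^sup>+v. emeasure lborel ((\<lambda>u. (u, v)) -` plane_tube U V \<epsilon>) \<partial>lborel)"
    unfolding lborel_prod[symmetric] by (rule lborel_pair.emeasure_pair_measure_alt2)
  also have "\<dots> = (\<integral>\<^sup>+v. indicator V v * emeasure lborel {u \<in> U. \<bar>v * u\<bar> \<le> \<epsilon>} \<partial>lborel)"
    by (intro nn_integral_cong) (auto simp: plane_tube_def indicator_def mult.commute)
  finally show ?thesis by (simp add: plane_tube_area)
qed

text \<open>The slice is the smaller of the intervals \<open>\<bar>v\<bar> < d\<close> and \<open>\<bar>v\<bar> \<le> \<epsilon> / \<bar>u\<bar>\<close>.\<close>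

lemma emeasure_slice:
  fixes u d \<epsilon> :: real
  assumes "\<epsilon> > 0" "d > 0"
  shows "emeasure lborel {v \<in> {-d<..<d}. \<bar>u * v\<bar> \<le> \<epsilon>} =
     ennreal (if \<bar>u\<bar> * d \<le> \<epsilon> then 2 * d else 2 * \<epsilon> / \<bar>u\<bar>)"
proof (cases "\<bar>u\<bar> * d \<le> \<epsilon>")
  case True
  have "\<bar>u * v\<bar> \<le> \<epsilon>" if "\<bar>v\<bar> < d" for v
    using True that mult_left_mono[of "\<bar>v\<bar>" d "\<bar>u\<bar>"] by (simp add: abs_mult)
  then have "{v \<in> {-d<..<d}. \<bar>u * v\<bar> \<le> \<epsilon>} = {-d<..<d}" by auto
  then show ?thesis using True assms by simp
next
  case False
  then have "u \<noteq> 0" using assms by auto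
  then have "\<bar>u * v\<bar> \<le> \<epsilon> \<longleftrightarrow> \<bar>v\<bar> \<le> \<epsilon> / \<bar>u\<bar>" for v
    by (simp add: abs_mult field_simps)
  moreover have "\<epsilon> / \<bar>u\<bar> < d"
    using False \<open>u \<noteq> 0\<close> by (simp add: field_simps)
  ultimately have "{v \<in> {-d<..<d}. \<bar>u * v\<bar> \<le> \<epsilon>} = {-(\<epsilon> / \<bar>u\<bar>)..\<epsilon> / \<bar>u\<bar>}"
    by fastforce
  then show ?thesis using False assms by simp
qed

text \<open>The interval stays away from \<open>0\<close>, so the integrand lies between two positive constants; the value
  of the integral does not matter for the threshold.\<close>

lemma nn_integral_inverse_interval:
  fixes c d :: real
  assumes d: "0 < d" "d < \<bar>c\<bar>"
  shows "\<exists>k>0. (\<integral>\<^sup>+y. indicator {c - d<..<c + d} y * ennreal (1 / \<bar>y\<bar>) \<partial>lborel) = ennreal k"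
proof -
  let ?I = "\<integral>\<^sup>+y. indicator {c - d<..<c + d} y * ennreal (1 / \<bar>y\<bar>) \<partial>lborel"
  have const: "(\<integral>\<^sup>+y. indicator {c - d<..<c + d} y * ennreal r \<partial>lborel) = ennreal (r * (2 * d))"
    if "r \<ge> 0" for r
    using that d by (subst nn_integral_multc) (simp_all add: ennreal_mult'' mult.commute)
  have "?I \<le> (\<integral>\<^sup>+y. indicator {c - d<..<c + d} y * ennreal (1 / (\<bar>c\<bar> - d)) \<partial>lborel)"
    using d by (intro nn_integral_mono)
       (auto simp: indicator_def intro!: ennreal_leI divide_left_mono)
  also have "\<dots> < \<infinity>" using d by (subst const) auto
  finally have fin: "?I < \<infinity>" .
  have "0 < ennreal (1 / (\<bar>c\<bar> + d) * (2 * d))" using d by simp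
  also have "\<dots> = (\<integral>\<^sup>+y. indicator {c - d<..<c + d} y * ennreal (1 / (\<bar>c\<bar> + d)) \<partial>lborel)"
    using d by (subst const) auto
  also have "\<dots> \<le> ?I"
    using d by (intro nn_integral_mono)
       (auto simp: indicator_def intro!: ennreal_leI divide_left_mono)
  finally have "0 < ?I" .
  with fin show ?thesis
    by (intro exI[of _ "enn2real ?I"]) (simp add: enn2real_positive_iff)
qed

text \<open>For \<open>u\<close> in the first interval \<open>\<bar>u\<bar> > \<bar>c\<bar> - d\<close>, so below the given bound on \<open>\<epsilon>\<close> every slice is the
  interval \<open>\<bar>v\<bar> \<le> \<epsilon> / \<bar>u\<bar>\<close> and the area is exactly linear in \<open>\<epsilon>\<close>.\<close>

lemma plane_tube_area_one_zero:
  fixes c d :: real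
  assumes d: "0 < d" "d < \<bar>c\<bar>"
  shows "\<exists>k>0. \<forall>\<epsilon>. 0 < \<epsilon> \<longrightarrow> \<epsilon> < d * (\<bar>c\<bar> - d) \<longrightarrow>
     emeasure lborel (plane_tube {c - d<..<c + d} {-d<..<d} \<epsilon>) = ennreal (k * \<epsilon>)"
proof -
  obtain k where k: "k > 0"
    "(\<integral>\<^sup>+y. indicator {c - d<..<c + d} y * ennreal (1 / \<bar>y\<bar>) \<partial>lborel) = ennreal k"
    using nn_integral_inverse_interval[OF d] by blast
  have "emeasure lborel (plane_tube {c - d<..<c + d} {-d<..<d} \<epsilon>) = ennreal (2 * k * \<epsilon>)"
    if \<epsilon>: "0 < \<epsilon>" "\<epsilon> < d * (\<bar>c\<bar> - d)" for \<epsilon>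
  proof -
    have "\<epsilon> < \<bar>y\<bar> * d" if "y \<in> {c - d<..<c + d}" for y
    proof -
      have "\<bar>c\<bar> - d < \<bar>y\<bar>" using that by auto
      then have "(\<bar>c\<bar> - d) * d < \<bar>y\<bar> * d" using d by simp
      then show ?thesis using \<epsilon> by (simp add: mult.commute)
    qed
    then have "indicator {c - d<..<c + d} y * emeasure lborel {v \<in> {-d<..<d}. \<bar>y * v\<bar> \<le> \<epsilon>} =
        (indicator {c - d<..<c + d} y * ennreal (1 / \<bar>y\<bar>)) * ennreal (2 * \<epsilon>)" for y
      using \<epsilon> d by (subst emeasure_slice)
        (force simp: indicator_def simp flip: ennreal_mult')+
    then have "emeasure lborel (plane_tube {c - d<..<c + d} {-d<..<d} \<epsilon>) =
        (\<integral>\<^sup>+y. (indicator {c - d<..<c + d} y * ennreal (1 / \<bar>y\<bar>)) * ennreal (2 * \<epsilon>) \<partial>lborel)"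
      by (subst plane_tube_area) auto
    also have "\<dots> = ennreal k * ennreal (2 * \<epsilon>)"
      by (subst nn_integral_multc) (simp_all add: k)
    also have "\<dots> = ennreal (2 * k * \<epsilon>)"
      using k(1) \<epsilon> by (simp add: mult_ac flip: ennreal_mult)
    finally show ?thesis .
  qed
  then show ?thesis using k(1) by (intro exI[of _ "2 * k"]) auto
qed

text \<open>The slices have full length \<open>2 * d\<close> for \<open>\<bar>u\<bar> \<le> \<epsilon> / d\<close>, contributing \<open>4 * \<epsilon>\<close>; on each side of this
  strip the length is \<open>2 * \<epsilon> / \<bar>u\<bar>\<close>, and its integral over \<open>\<epsilon> / d < \<bar>u\<bar> < d\<close> produces the logarithm.\<close>

lemma plane_tube_area_cross:
  fixes d \<epsilon> :: real
  assumes d: "0 < d" and \<epsilon>: "0 < \<epsilon>" "\<epsilon> < d\<^sup>2"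
  shows "emeasure lborel (plane_tube {-d<..<d} {-d<..<d} \<epsilon>) = ennreal (4 * \<epsilon> * (1 + ln (d\<^sup>2 / \<epsilon>)))"
proof -
  define g where "g u = ennreal (if \<bar>u\<bar> * d \<le> \<epsilon> then 2 * d else 2 * \<epsilon> / \<bar>u\<bar>)" for u
  define c where "c = \<epsilon> / d"
  have c: "0 < c" "c < d" using assms by (simp_all add: c_def field_simps power2_eq_square)
  have [measurable]: "g \<in> borel_measurable borel" unfolding g_def by measurable
  let ?R = "\<integral>\<^sup>+u. indicator {c<..<d} u * g u \<partial>lborel"
  \<comment> \<open>\<open>c\<close> is where the two forms of the slice length \<open>g\<close> meet.\<close>
  have mid: "(\<integral>\<^sup>+u. indicator {-c..c} u * g u \<partial>lborel) = ennreal (4 * \<epsilon>)"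
  proof -
    have "(\<integral>\<^sup>+u. indicator {-c..c} u * g u \<partial>lborel) = (\<integral>\<^sup>+u. ennreal (2 * d) * indicator {-c..c} u \<partial>lborel)"
      using d by (intro nn_integral_cong) (auto simp: indicator_def g_def c_def field_simps abs_if)
    also have "\<dots> = ennreal (2 * d) * ennreal (2 * c)"
      using c by (simp add: nn_integral_cmult_indicator)
    also have "\<dots> = ennreal (4 * \<epsilon>)"
      using c d by (simp add: c_def flip: ennreal_mult)
    finally show ?thesis .
  qed
  have right: "?R = ennreal (2 * \<epsilon> * ln (d\<^sup>2 / \<epsilon>))"
  proof -
    have "?R = (\<integral>\<^sup>+u. ennreal (2 * \<epsilon> / u) * indicator {c..d} u \<partial>lborel)"
    proof (rule nn_integral_cong_AE)
      show "AE u in lborel. indicator {c<..<d} u * g u = ennreal (2 * \<epsilon> / u) * indicator {c..d} u"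
        using AE_lborel_singleton[of c] AE_lborel_singleton[of d]
      proof eventually_elim
        fix u assume u: "u \<noteq> c" "u \<noteq> d"
        have "\<epsilon> < \<bar>u\<bar> * d" if "c < u"
        proof -
          have "\<bar>u\<bar> = u" using that c by simp
          then show ?thesis using that d by (simp add: c_def field_simps)
        qed
        then show "indicator {c<..<d} u * g u = ennreal (2 * \<epsilon> / u) * indicator {c..d} u"
          using u c by (auto simp: indicator_def g_def)
      qed
    qed
    also have "\<dots> = ennreal (2 * \<epsilon> * ln d - 2 * \<epsilon> * ln c)"
      using c \<epsilon> by (intro nn_integral_FTC_Icc) (auto intro!: derivative_eq_intros)
    also have "2 * \<epsilon> * ln d - 2 * \<epsilon> * ln c = 2 * \<epsilon> * ln (d\<^sup>2 / \<epsilon>)"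
      using d \<epsilon> by (simp add: c_def ln_div ln_realpow algebra_simps)
    finally show ?thesis .
  qed
  have left: "(\<integral>\<^sup>+u. indicator {-d<..<-c} u * g u \<partial>lborel) = ?R"
    by (subst nn_integral_real_affine[where c = "-1" and t = 0])
       (auto intro!: nn_integral_cong simp: indicator_def g_def)
  have "emeasure lborel (plane_tube {-d<..<d} {-d<..<d} \<epsilon>) = (\<integral>\<^sup>+u. indicator {-d<..<d} u * g u \<partial>lborel)"
    unfolding g_def emeasure_slice[OF \<epsilon>(1) d, symmetric] by (rule plane_tube_area) simp_all
  also have "\<dots> = (\<integral>\<^sup>+u. indicator {-c..c} u * g u + (indicator {c<..<d} u * g u + indicator {-d<..<-c} u * g u) \<partial>lborel)"
    using c by (intro nn_integral_cong) (auto simp: indicator_def)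
  also have "\<dots> = ennreal (4 * \<epsilon>) + (ennreal (2 * \<epsilon> * ln (d\<^sup>2 / \<epsilon>)) + ennreal (2 * \<epsilon> * ln (d\<^sup>2 / \<epsilon>)))"
    by (subst nn_integral_add, simp, simp, subst nn_integral_add) (simp_all add: left mid right)
  also have "\<dots> = ennreal (4 * \<epsilon> * (1 + ln (d\<^sup>2 / \<epsilon>)))"
    using \<epsilon> by (simp add: algebra_simps flip: ennreal_plus)
  finally show ?thesis .
qed

section \<open>The polynomial in the coordinates given by its two factors\<close>

definition gap :: "real ^ 4 \<Rightarrow> real" where "gap w = w $ 4 - w $ 3"
definition minor :: "real ^ 4 \<Rightarrow> real" where "minor w = w $ 1 * w $ 4 - w $ 2 * w $ 3"

lemma p2_eq_gap_times_minor: "p2 w = gap w * minor w"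
  by (simp add: p2_def gap_def minor_def Let_def algebra_simps)

lemma continuous_gap_minor [continuous_intros]:
  "continuous_on S gap" "continuous_on S minor"
  unfolding gap_def minor_def by (intro continuous_intros)+

lemma gap_minor_borel [measurable]:
  "gap \<in> borel_measurable borel" "minor \<in> borel_measurable borel"
  by (intro borel_measurable_continuous_onI continuous_intros)+

text \<open>For fixed \<open>y\<^sub>2 > 0\<close>, \<open>x\<^sub>2\<close> and \<open>y\<^sub>1\<close> the minor is an affine function of \<open>x\<^sub>1\<close> with slope \<open>y\<^sub>2\<close>, and for
  fixed \<open>y\<^sub>2\<close> the gap is \<open>y\<^sub>2 - y\<^sub>1\<close>.  Integrating over \<open>x\<^sub>1\<close> first and then over \<open>y\<^sub>1\<close> thus turns the two
  inner integrals into an area in the \<open>(u, v)\<close>-plane, at the cost of the factor \<open>1 / y\<^sub>2\<close>.\<close>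

lemma emeasure_tube_in_factor_coordinates:
  fixes X Y U V :: "real set"
  assumes [measurable]: "X \<in> sets borel" "Y \<in> sets borel" "U \<in> sets borel" "V \<in> sets borel"
    and Y: "Y \<subseteq> {0<..}"
  defines "W \<equiv> {w. w $ 2 \<in> X \<and> w $ 4 \<in> Y \<and> gap w \<in> U \<and> minor w \<in> V}"
  shows "emeasure lborel (tube p2 W \<epsilon>) =
     emeasure lborel X * (\<integral>\<^sup>+y. indicator Y y * ennreal (1 / \<bar>y\<bar>) \<partial>lborel) *
     emeasure lborel (plane_tube U V \<epsilon>)"
proof -
  define F :: "real \<Rightarrow> real \<Rightarrow> ennreal" where "F u v = indicator (plane_tube U V \<epsilon>) (u, v)" for u v
  define A where "A = emeasure lborel (plane_tube U V \<epsilon>)"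
  have F_meas: "(\<lambda>(u, v). F u v) \<in> borel_measurable (borel \<Otimes>\<^sub>M borel)"
    unfolding F_def borel_prod case_prod_eta by simp
  have [measurable]: "(\<lambda>x. F (f x) (g x)) \<in> borel_measurable M"
    if "f \<in> borel_measurable M" "g \<in> borel_measurable M" for f g :: "'z \<Rightarrow> real" and M
    using measurable_compose[OF measurable_Pair[OF that] F_meas] by simp
  have tube: "tube p2 W \<epsilon> = {w. w $ 4 \<in> Y \<and> w $ 2 \<in> X \<and> (gap w, minor w) \<in> plane_tube U V \<epsilon>}"
    by (auto simp: tube_def W_def plane_tube_def p2_eq_gap_times_minor)
  have nth [measurable]: "(\<lambda>w :: real ^ 4. w $ i) \<in> borel_measurable borel" for i
    by (intro borel_measurable_continuous_onI continuous_intros)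
  have ind: "indicator (tube p2 W \<epsilon>) w = indicator Y (w $ 4) * (indicator X (w $ 2) * F (gap w) (minor w))"
    for w by (simp add: tube F_def indicator_def)
  have [measurable]: "tube p2 W \<epsilon> \<in> sets borel"
    unfolding tube by measurable
  have "A = (\<integral>\<^sup>+q. (case q of (u, v) \<Rightarrow> F u v) \<partial>(lborel \<Otimes>\<^sub>M lborel))"
    unfolding A_def lborel_prod by (simp add: F_def case_prod_eta)
  also have "\<dots> = (\<integral>\<^sup>+u. \<integral>\<^sup>+v. F u v \<partial>lborel \<partial>lborel)"
    using F_meas by (subst lborel.nn_integral_fst[symmetric]) (simp_all cong: measurable_cong_sets)
  finally have A: "A = (\<integral>\<^sup>+u. \<integral>\<^sup>+v. F u v \<partial>lborel \<partial>lborel)" .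
  have inner: "(\<integral>\<^sup>+x1. F u (x1 * y2 - c) \<partial>lborel) = ennreal (1 / \<bar>y2\<bar>) * (\<integral>\<^sup>+v. F u v \<partial>lborel)"
    if "y2 > 0" for u c y2
    using that by (subst nn_integral_real_affine[where c = "1 / y2" and t = "c / y2"]) (simp_all add: field_simps)
  have outer: "(\<integral>\<^sup>+y1. \<integral>\<^sup>+v. F (y2 - y1) v \<partial>lborel \<partial>lborel) = A" for y2
    unfolding A by (subst nn_integral_real_affine[where c = "-1" and t = y2]) simp_all
  have slice: "indicator Y y2 *
       (\<integral>\<^sup>+x2. indicator X x2 * (\<integral>\<^sup>+y1. \<integral>\<^sup>+x1. F (y2 - y1) (x1 * y2 - x2 * y1) \<partial>lborel \<partial>lborel) \<partial>lborel)
     = indicator Y y2 * ennreal (1 / \<bar>y2\<bar>) * (emeasure lborel X * A)" for y2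
  proof (cases "y2 \<in> Y")
    case True
    then have "y2 > 0" using Y by auto
    then show ?thesis
      by (simp add: inner nn_integral_cmult outer nn_integral_multc mult_ac)
  qed simp
  have "emeasure lborel (tube p2 W \<epsilon>) = (\<integral>\<^sup>+w. indicator (tube p2 W \<epsilon>) w \<partial>lborel)"
    by simp
  also have "\<dots> = (\<integral>\<^sup>+y2. indicator Y y2 * (\<integral>\<^sup>+x2. indicator X x2 * (\<integral>\<^sup>+y1. \<integral>\<^sup>+x1. F (y2 - y1) (x1 * y2 - x2 * y1) \<partial>lborel \<partial>lborel) \<partial>lborel) \<partial>lborel)"
    by (subst nn_integral_point_of, simp)
       (simp add: ind gap_def minor_def nn_integral_cmult)
  also have "\<dots> = (\<integral>\<^sup>+y2. indicator Y y2 * ennreal (1 / \<bar>y2\<bar>) \<partial>lborel) * (emeasure lborel X * A)"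
    unfolding slice by (simp add: nn_integral_multc)
  finally show ?thesis by (simp add: A_def mult_ac)
qed

lemma real_polynomial_function_nth: "real_polynomial_function (\<lambda>w :: real ^ 'n. w $ i)"
  by (rule real_polynomial_function.intros(1)) (rule bounded_linear_vec_nth)

lemma real_polynomial_function_p2: "real_polynomial_function p2"
  unfolding p2_def Let_def
  by (intro real_polynomial_function.intros(2-) real_polynomial_function_diff
        real_polynomial_function_nth)

definition cell :: "real ^ 4 \<Rightarrow> real \<Rightarrow> (real ^ 4) set" where
  "cell a d = {w. w $ 2 \<in> {a $ 2 - d<..<a $ 2 + d} \<and> w $ 4 \<in> {a $ 4 - d<..<a $ 4 + d} \<and>
     gap w \<in> {gap a - d<..<gap a + d} \<and> minor w \<in> {minor a - d<..<minor a + d}}"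

lemma open_cell: "open (cell a d)"
  unfolding cell_def greaterThanLessThan_iff
  by (intro open_Collect_conj open_Collect_less continuous_intros)

text \<open>The inverse \<open>\<Psi>\<close> of the coordinate change is continuous at the image of \<open>a\<close>, since \<open>y\<^sub>2 > 0\<close> there, and
  a small cell is the image under \<open>\<Psi>\<close> of a cube around that image.\<close>

lemma cells_shrink:
  assumes a: "a $ 4 > 0" and S: "open S" "a \<in> S"
  shows "\<exists>d0>0. \<forall>d. d \<le> d0 \<longrightarrow> cell a d \<subseteq> S"
proof -
  define \<Psi> :: "real \<times> real \<times> real \<times> real \<Rightarrow> real ^ 4" where
    "\<Psi> = (\<lambda>(y2, x2, u, v). point_of (y2, x2, y2 - u, (v + x2 * (y2 - u)) / y2))"
  have \<Psi>: "\<Psi> (w $ 4, w $ 2, gap w, minor w) = w" if "w $ 4 \<noteq> 0" for w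
    using that by (simp add: \<Psi>_def vec_eq_iff forall_4 gap_def minor_def)
  let ?q = "(a $ 4, a $ 2, gap a, minor a)"
  define \<phi> :: "real \<times> real \<times> real \<times> real \<Rightarrow> real \<times> real \<times> real \<times> real" where
    "\<phi> q = (fst q, fst (snd q), fst q - fst (snd (snd q)),
       (snd (snd (snd q)) + fst (snd q) * (fst q - fst (snd (snd q)))) / fst q)" for q
  have "isCont \<phi> ?q"
    unfolding \<phi>_def using a by (intro continuous_intros) simp
  moreover have "isCont point_of q" for q
    by (rule continuous_on_interior[OF continuous_point_of]) simp
  ultimately have "isCont (\<lambda>q. point_of (\<phi> q)) ?q"
    by (rule isCont_o2)
  moreover have "(\<lambda>q. point_of (\<phi> q)) = \<Psi>"
    by (simp add: \<Psi>_def \<phi>_def fun_eq_iff)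
  ultimately have "isCont \<Psi> ?q" by simp
  then have "(\<Psi> \<longlongrightarrow> \<Psi> ?q) (nhds ?q)"
    by (simp only: isCont_def tendsto_at_iff_tendsto_nhds)
  moreover have "\<Psi> ?q \<in> S" using \<Psi>[of a] a S(2) by simp
  ultimately have "\<forall>\<^sub>F q in nhds ?q. \<Psi> q \<in> S"
    using S(1) by (blast intro: topological_tendstoD)
  then obtain e where e: "e > 0" "\<And>q. dist q ?q < e \<Longrightarrow> \<Psi> q \<in> S"
    unfolding eventually_nhds_metric by blast
  \<comment> \<open>\<open>e / 4\<close> because the distance of two quadruples is at most the sum of the four
    coordinate distances; \<open>a $ 4\<close> to keep the last coordinate positive.\<close>
  define d0 where "d0 = min (e / 4) (a $ 4)"
  have "w \<in> S" if d: "d \<le> d0" and w: "w \<in> cell a d" for w d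
  proof -
    let ?p = "(w $ 4, w $ 2, gap w, minor w)"
    have "dist ?p ?q \<le> \<bar>w $ 4 - a $ 4\<bar> + (\<bar>w $ 2 - a $ 2\<bar> + (\<bar>gap w - gap a\<bar> + \<bar>minor w - minor a\<bar>))"
      unfolding dist_norm diff_Pair
      by (intro order.trans[OF norm_Pair_le] add_mono) (simp_all add: order.trans[OF norm_Pair_le])
    also have "\<dots> < d + (d + (d + d))"
      using w by (intro add_strict_mono) (auto simp: cell_def abs_less_iff)
    also have "\<dots> \<le> e" using d by (simp add: d0_def)
    finally have "\<Psi> ?p \<in> S" by (rule e(2))
    moreover have "w $ 4 \<noteq> 0" using w d by (auto simp: cell_def d0_def)
    ultimately show ?thesis by (simp add: \<Psi>)
  qed
  then show ?thesis
    using e(1) a by (intro exI[of _ d0]) (auto simp: d0_def)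
qed

lemma measure_tube_cell:
  assumes d: "0 < d" "d < a $ 4"
  shows "\<exists>k>0. \<forall>\<epsilon>. measure lebesgue (tube p2 (cell a d) \<epsilon>) =
     k * measure lborel (plane_tube {gap a - d<..<gap a + d} {minor a - d<..<minor a + d} \<epsilon>)"
proof -
  obtain k where k: "k > 0"
    "(\<integral>\<^sup>+y. indicator {a $ 4 - d<..<a $ 4 + d} y * ennreal (1 / \<bar>y\<bar>) \<partial>lborel) = ennreal k"
    using nn_integral_inverse_interval[of d "a $ 4"] d by auto
  have "continuous_on UNIV p2"
    unfolding p2_eq_gap_times_minor[abs_def] by (intro continuous_intros)
  then have "closed {w. \<bar>p2 w\<bar> \<le> \<epsilon>}" for \<epsilon>
    by (intro closed_Collect_le continuous_intros)
  moreover have "tube p2 (cell a d) \<epsilon> = cell a d \<inter> {w. \<bar>p2 w\<bar> \<le> \<epsilon>}" for \<epsilon>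
    by (auto simp: tube_def)
  ultimately have "tube p2 (cell a d) \<epsilon> \<in> sets borel" for \<epsilon>
    using open_cell by auto
  then have "measure lebesgue (tube p2 (cell a d) \<epsilon>) = measure lborel (tube p2 (cell a d) \<epsilon>)" for \<epsilon>
    by simp
  also have "measure lborel (tube p2 (cell a d) \<epsilon>) =
     2 * d * k * measure lborel (plane_tube {gap a - d<..<gap a + d} {minor a - d<..<minor a + d} \<epsilon>)" for \<epsilon>
    unfolding measure_def cell_def using d k(1)
    by (subst emeasure_tube_in_factor_coordinates) (auto simp: k(2) enn2real_mult)
  finally show ?thesis
    using k(1) d by (intro exI[of _ "2 * d * k"]) auto
qed

text \<open>The size of the cell keeps a factor that is nonzero at \<open>a\<close> away from \<open>0\<close>, so the square in the
  \<open>(u, v)\<close>-plane meets exactly the axes that contain its centre.\<close>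

lemma volume_pair_cell:
  assumes d: "0 < d" "d < a $ 4" and zero: "gap a * minor a = 0"
    and small: "gap a \<noteq> 0 \<Longrightarrow> d < \<bar>gap a\<bar>" "minor a \<noteq> 0 \<Longrightarrow> d < \<bar>minor a\<bar>"
  shows "volume_pair p2 (cell a d) (if gap a = 0 \<and> minor a = 0 then (1, 2) else (1, 1))"
proof -
  let ?A = "\<lambda>\<epsilon>. measure lborel (plane_tube {gap a - d<..<gap a + d} {minor a - d<..<minor a + d} \<epsilon>)"
  obtain k where k: "k > 0" "\<And>\<epsilon>. measure lebesgue (tube p2 (cell a d) \<epsilon>) = k * ?A \<epsilon>"
    using measure_tube_cell[OF d] by metis
  show ?thesis
  proof (cases "gap a = 0 \<and> minor a = 0")
    case True
    have "?A \<epsilon> = 4 * \<epsilon> * (1 + ln (d\<^sup>2 / \<epsilon>))" if "\<epsilon> \<in> {0<..<d\<^sup>2}" for \<epsilon>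
    proof -
      have "ln (d\<^sup>2 / \<epsilon>) \<ge> 0" using that by (intro ln_ge_zero) (simp add: field_simps)
      then show ?thesis using that True d plane_tube_area_cross[of d \<epsilon>] by (simp add: measure_def)
    qed
    then have "\<forall>\<^sub>F \<epsilon> in at_right 0. k * ?A \<epsilon> = k * (4 * \<epsilon> * (1 + ln (d\<^sup>2 / \<epsilon>)))"
      using d by (intro eventually_at_rightI[of 0 "d\<^sup>2"]) auto
    moreover have "(\<lambda>\<epsilon>. k * (4 * \<epsilon> * (1 + ln (d\<^sup>2 / \<epsilon>))))
        \<sim>[at_right 0] (\<lambda>\<epsilon>. (4 * k) * \<epsilon> powr 1 * (- ln \<epsilon>) ^ (2 - 1))"
      using k(1) d by real_asymp
    ultimately have "(\<lambda>\<epsilon>. k * ?A \<epsilon>) \<sim>[at_right 0] (\<lambda>\<epsilon>. (4 * k) * \<epsilon> powr 1 * (- ln \<epsilon>) ^ (2 - 1))"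
      by (rule asymp_equiv_trans[OF asymp_equiv_refl_ev])
    moreover have "4 * k > 0" using k(1) by simp
    ultimately show ?thesis
      using True unfolding volume_pair_def k(2) by (auto intro!: exI[of _ "4 * k"])
  next
    case False
    have "\<exists>c>0. \<exists>e>0. \<forall>\<epsilon>\<in>{0<..<e}. ?A \<epsilon> = c * \<epsilon>"
    proof (cases "gap a = 0")
      case True
      then have lt: "d < \<bar>minor a\<bar>" using False small by auto
      obtain c where c: "c > 0" "\<And>\<epsilon>. 0 < \<epsilon> \<Longrightarrow> \<epsilon> < d * (\<bar>minor a\<bar> - d) \<Longrightarrow>
          emeasure lborel (plane_tube {minor a - d<..<minor a + d} {-d<..<d} \<epsilon>) = ennreal (c * \<epsilon>)"
        using plane_tube_area_one_zero[OF d(1) lt] by blast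
      have "?A \<epsilon> = c * \<epsilon>" if "\<epsilon> \<in> {0<..<d * (\<bar>minor a\<bar> - d)}" for \<epsilon>
        using that c(1) c(2)[of \<epsilon>] plane_tube_commute[of "{-d<..<d}" "{minor a - d<..<minor a + d}" \<epsilon>] True
        by (simp add: measure_def)
      moreover have "0 < d * (\<bar>minor a\<bar> - d)" using d(1) lt by simp
      ultimately show ?thesis using c(1) by blast
    next
      case gap: False
      then have lt: "d < \<bar>gap a\<bar>" and "minor a = 0" using zero small by auto
      obtain c where c: "c > 0" "\<And>\<epsilon>. 0 < \<epsilon> \<Longrightarrow> \<epsilon> < d * (\<bar>gap a\<bar> - d) \<Longrightarrow>
          emeasure lborel (plane_tube {gap a - d<..<gap a + d} {-d<..<d} \<epsilon>) = ennreal (c * \<epsilon>)"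
        using plane_tube_area_one_zero[OF d(1) lt] by blast
      have "?A \<epsilon> = c * \<epsilon>" if "\<epsilon> \<in> {0<..<d * (\<bar>gap a\<bar> - d)}" for \<epsilon>
        using that c(1) c(2)[of \<epsilon>] \<open>minor a = 0\<close>
        by (simp add: measure_def)
      moreover have "0 < d * (\<bar>gap a\<bar> - d)" using d(1) lt by simp
      ultimately show ?thesis using c(1) by blast
    qed
    then obtain c e where c: "c > 0" "e > 0" "\<And>\<epsilon>. \<epsilon> \<in> {0<..<e} \<Longrightarrow> ?A \<epsilon> = c * \<epsilon>" by metis
    have "\<forall>\<^sub>F \<epsilon> in at_right 0. k * ?A \<epsilon> = (k * c) * \<epsilon> powr 1 * (- ln \<epsilon>) ^ (1 - 1)"
      using c by (intro eventually_at_rightI[of 0 e]) auto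
    then have "(\<lambda>\<epsilon>. k * ?A \<epsilon>) \<sim>[at_right 0] (\<lambda>\<epsilon>. (k * c) * \<epsilon> powr 1 * (- ln \<epsilon>) ^ (1 - 1))"
      by (rule asymp_equiv_refl_ev)
    moreover have "k * c > 0" using k(1) c(1) by simp
    ultimately show ?thesis
      using False unfolding volume_pair_def k(2) by (auto intro!: exI[of _ "k * c"])
  qed
qed

theorem proposition5p1:
  fixes a :: "real ^ 4"
  assumes "\<And>i. a $ i > 0"
    and "p2 a = 0"
  shows "has_RLCT p2 a (if a \<in> Delta2 then (1, 2) else (1, 1))"
proof (rule has_RLCT_if_small_nbhds)
  show "continuous_on UNIV p2"
    by (rule continuous_on_polymonial_function)
       (simp add: real_polynomial_function_p2 flip: real_polynomial_function_eq)
  have zero: "gap a * minor a = 0" using assms(2) by (simp add: p2_eq_gap_times_minor)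
  have Delta2: "a \<in> Delta2 \<longleftrightarrow> gap a = 0 \<and> minor a = 0"
    using assms(1) by (auto simp: Delta2_def gap_def minor_def less_imp_neq[symmetric])
  fix S assume S: "open S" "a \<in> S"
  then obtain d0 where d0: "d0 > 0" "\<And>d. d \<le> d0 \<Longrightarrow> cell a d \<subseteq> S \<inter> ball a 1"
    using cells_shrink[of a "S \<inter> ball a 1"] assms(1) by auto
  \<comment> \<open>Small enough for the cell to lie in \<open>S\<close>, to keep the last coordinate positive, and
    to keep away from \<open>0\<close> a factor that does not vanish at \<open>a\<close>.\<close>
  define r :: "real \<Rightarrow> real" where "r s = (if s = 0 then 1 else \<bar>s\<bar> / 2)" for s
  define d where "d = min (min d0 (a $ 4 / 2)) (min (r (gap a)) (r (minor a)))"
  have r: "0 < r s" "s \<noteq> 0 \<Longrightarrow> r s < \<bar>s\<bar>" for s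
    by (auto simp: r_def)
  have "0 < d" "d \<le> d0" "d \<le> a $ 4 / 2" "d \<le> r (gap a)" "d \<le> r (minor a)"
    using d0(1) assms(1)[of 4] r(1) by (simp_all add: d_def)
  then have d: "0 < d" "d \<le> d0" "d < a $ 4"
    "gap a \<noteq> 0 \<Longrightarrow> d < \<bar>gap a\<bar>" "minor a \<noteq> 0 \<Longrightarrow> d < \<bar>minor a\<bar>"
    using r(2)[of "gap a"] r(2)[of "minor a"] assms(1)[of 4] by linarith+
  have sub: "cell a d \<subseteq> S \<inter> ball a 1" using d0 d by auto
  then have "compact (closure (cell a d))"
    using bounded_subset[OF bounded_ball, of "cell a d" a 1] by (simp add: compact_closure)
  then have "admissible_nbhd p2 a (cell a d)"
    using open_cell d(1) real_polynomial_function_imp_real_analytic_on[OF real_polynomial_function_p2]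
    by (auto simp: admissible_nbhd_def cell_def)
  moreover have "volume_pair p2 (cell a d) (if a \<in> Delta2 then (1, 2) else (1, 1))"
    unfolding Delta2 using volume_pair_cell[OF d(1,3) zero d(4,5)] .
  ultimately show "\<exists>W\<subseteq>S. admissible_nbhd p2 a W \<and> volume_pair p2 W (if a \<in> Delta2 then (1, 2) else (1, 1))"
    using sub by (intro exI[of _ "cell a d"]) auto
qed (fact assms(2))

end
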